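(* Let $Q\ge 2$ be an integer, let $Q^{1/2}$ denote a choice of one of the two square roots of $Q$, and let $q,\rho,v,K$ be complex numbers with $q\neq 0$ satisfying $$-q\rho=Q^{-1/2}v,\qquad q+q^{-1}=Q^{1/2},\qquad v=e^{K}-1 .$$ Suppose that the model is at criticality, i.e. $Q^{-1/2}v=1$ (equivalently $-\rho q=1$), and that $\rho=1$. Then $Q=4$, with $Q^{1/2}=-2$, $q=-1$, $v=-2$ and $e^{K}=-1$; hence $K=(2n+1)i\pi$ for some integer $n$. Conversely, these values satisfy all the conditions.
   Context: The $Q$-state Potts partition function of a finite graph $G$ is $P_G=\sum_\sigma e^{K E(\sigma)}$, where $\sigma$ runs over assignments of elements of $\{1,\dots,Q\}$ to the nodes of $G$, $E(\sigma)$ is the number of edges whose end-nodes receive the same assignment, and $K=J/(kT)$ ($J=\pm1$, $k$ Boltzmann's constant, $T$ temperature). The $\rho$-bracket of a link diagram is defined by the expansion, at each crossing, [diagram] $=$ [$A$-smoothing] $-\,q\rho\,$[$B$-smoothing], with each loop having value $q+q^{-1}$. The displayed relations between $(q,\rho)$ and $(Q,v)$ are those under which the $\rho$-bracket specializes to the bracket expansion of the Potts model, in which the $B$-smoothing has coefficient $Q^{-1/2}v$ and loops have value $Q^{1/2}$. "Criticality" means $Q^{-1/2}v=1$. When $\rho=1$ the $\rho$-bracket is the Khovanov form of the bracket polynomial. *)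

theory Defs
  imports Complex_Main
begin

text \<open>
  Throughout, \<open>s\<close> is the chosen square root \<open>Q\<^sup>1\<^sup>/\<^sup>2\<close> (either sign is allowed) and
  \<open>Q\<^sup>-\<^sup>1\<^sup>/\<^sup>2\<close> is \<open>inverse s\<close>, the inverse of that same root.
\<close>

text \<open>
  The \<open>\<rho>\<close>-bracket has \<open>B\<close>-smoothing coefficient \<open>- q * \<rho>\<close> and loop value \<open>q + inverse q\<close>;
  the bracket expansion of the \<open>Q\<close>-state Potts model has \<open>inverse s * v\<close> and \<open>s\<close>, where
  \<open>v = exp K - 1\<close>. The relations equate the two.
\<close>

definition rho_potts_relations ::
  "nat \<Rightarrow> complex \<Rightarrow> complex \<Rightarrow> complex \<Rightarrow> complex \<Rightarrow> complex \<Rightarrow> bool" where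
  "rho_potts_relations Q s q \<rho> v K \<longleftrightarrow>
     Q \<ge> 2 \<and> s ^ 2 = of_nat Q \<and> q \<noteq> 0 \<and>
     - q * \<rho> = inverse s * v \<and> q + inverse q = s \<and> v = exp K - 1"

definition potts_critical :: "complex \<Rightarrow> complex \<Rightarrow> bool" where
  "potts_critical s v \<longleftrightarrow> inverse s * v = 1"

end

theory Submission
  imports Defs "HOL-Analysis.Complex_Transcendental"
begin

text \<open>
  At criticality the common value of the two \<open>B\<close>-smoothing coefficients is \<open>1\<close>, so \<open>\<rho> = 1\<close>
  leaves no freedom in \<open>q\<close>: it is \<open>-1\<close>. The loop value \<open>q + inverse q\<close> is then \<open>-2\<close>, which
  selects the negative square root of \<open>Q = 4\<close>, and criticality turns into \<open>v = s = -2\<close>, that is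
  \<open>exp K = -1\<close>. Since \<open>exp (\<i> * pi) = -1\<close> and the complex exponential has period \<open>2 * \<i> * pi\<close>,
  the solutions \<open>K\<close> are exactly the odd multiples of \<open>\<i> * pi\<close>.
\<close>

lemma exp_eq_minus_one_iff:
  fixes K :: complex
  shows "exp K = - 1 \<longleftrightarrow> (\<exists>n::int. K = (2 * of_int n + 1) * \<i> * of_real pi)"
proof -
  have "exp K = - 1 \<longleftrightarrow> exp K = exp (of_real pi * \<i>)"
    by simp
  also have "\<dots> \<longleftrightarrow> (\<exists>n::int. K = of_real pi * \<i> + (of_int (2 * n) * of_real pi) * \<i>)"
    by (simp only: exp_eq of_real_mult of_real_of_int_eq)
  also have "\<dots> \<longleftrightarrow> (\<exists>n::int. K = (2 * of_int n + 1) * \<i> * of_real pi)"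
    by (simp add: algebra_simps)
  finally show ?thesis .
qed

lemma potts_critical_iff_rho:
  assumes "rho_potts_relations Q s q \<rho> v K"
  shows "potts_critical s v \<longleftrightarrow> - \<rho> * q = 1"
  using assms by (simp add: rho_potts_relations_def potts_critical_def mult.commute)

lemma critical_khovanov_values:
  assumes rel: "rho_potts_relations Q s q \<rho> v K"
    and crit: "potts_critical s v"
    and "\<rho> = 1"
  shows "Q = 4 \<and> s = - 2 \<and> q = - 1 \<and> v = - 2 \<and> exp K = - 1"
proof -
  have "- q = 1"
    using potts_critical_iff_rho [OF rel] crit \<open>\<rho> = 1\<close> by simp
  then have q: "q = - 1"
    by (metis minus_minus)
  have s: "s = - 2"
    using rel q by (simp add: rho_potts_relations_def)
  have "(of_nat Q :: complex) = of_nat 4"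
    using rel s by (simp add: rho_potts_relations_def)
  then have Q: "Q = 4"
    by (simp only: of_nat_eq_iff)
  have v: "v = - 2"
    using crit s by (simp add: potts_critical_def field_simps) (metis minus_minus)
  have "exp K = v + 1"
    using rel by (simp add: rho_potts_relations_def)
  with q s Q v show ?thesis
    by simp
qed

lemma khovanov_values_critical:
  assumes "Q = 4" "s = - 2" "q = - 1" "\<rho> = 1" "v = - 2" "exp K = - 1"
  shows "rho_potts_relations Q s q \<rho> v K \<and> potts_critical s v"
  using assms by (simp add: rho_potts_relations_def potts_critical_def)

theorem mainTheorem2:
  fixes Q :: nat and s q \<rho> v K :: complex
  shows
    "(rho_potts_relations Q s q \<rho> v K \<longrightarrow> (potts_critical s v \<longleftrightarrow> - \<rho> * q = 1)) \<and>
     (rho_potts_relations Q s q \<rho> v K \<and> potts_critical s v \<and> \<rho> = 1 \<longrightarrow>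
        Q = 4 \<and> s = - 2 \<and> q = - 1 \<and> v = - 2 \<and> exp K = - 1 \<and>
        (\<exists>n::int. K = (2 * of_int n + 1) * \<i> * of_real pi)) \<and>
     (Q = 4 \<and> s = - 2 \<and> q = - 1 \<and> \<rho> = 1 \<and> v = - 2 \<and> exp K = - 1 \<longrightarrow>
        rho_potts_relations Q s q \<rho> v K \<and> potts_critical s v) \<and>
     (exp K = - 1 \<longleftrightarrow> (\<exists>n::int. K = (2 * of_int n + 1) * \<i> * of_real pi))"
  using potts_critical_iff_rho critical_khovanov_values khovanov_values_critical
    exp_eq_minus_one_iff
  by blast

end
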